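(* Let $c:\mathbb{R}\to\mathbb{R}^n$ be a smooth curve and let $\epsilon>0$. For $s\in\mathbb{R}$ put $$c_s(t):=\tfrac14\{c(t-s)+2c(t)+c(t+s)\},\qquad t\in\mathbb{R}.$$ Suppose there are a smooth one-parameter family $s\in(-\epsilon,\epsilon)\mapsto A(s)\in GL(n,\mathbb{R})$ and a smooth curve $s\in(-\epsilon,\epsilon)\mapsto b(s)\in\mathbb{R}^n$ such that $$c_s(t)=A(s)c(t)+b(s)\qquad\text{for all }t\in\mathbb{R},\ s\in(-\epsilon,\epsilon).$$ Assume in addition that for some $t_0\in\mathbb{R}$ the vectors $\dot c(t_0),\ddot c(t_0),\ldots,c^{(n)}(t_0)$ are linearly independent. Set $B:=2A''(0)\in M(n;\mathbb{R})$ and $d:=2b''(0)\in\mathbb{R}^n$. Then: (i) $c$ is the unique solution of the differential equation $\ddot c(t)=Bc(t)+d$ with initial conditions $v=c(0)$, $w=\dot c(0)$. (ii) The functions $s\mapsto A(s)$ and $s\mapsto b(s)$ satisfy the differential equations $$A''(s)=\left(A(s)-\mathbb{1}/2\right)B,\qquad b''(s)=\left(A(s)-\mathbb{1}/2\right)d$$ with initial conditions $A(0)=\mathbb{1}$, $b(0)=0$, $A'(0)=0$, $b'(0)=0$. (iii) In particular, $A(s)=\frac12\left(\mathbb{1}+\mathrm{co}_B(s)\right)$. Moreover, the Jordan normal form of each matrix $A(s)$ satisfies the following: for every real $\lambda<0$ and every $m\ge 1$, the number of Jordan blocks $J_m(\lambda)$ occurring in the Jordan normal form of $A(s)$ is even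 (possibly zero).
   Context: $M(n;\mathbb{R})$ is the space of real $n\times n$ matrices and $\mathbb{1}$ the identity matrix. For $B\in M(n;\mathbb{R})$ and $t\in\mathbb{R}$, $\mathrm{co}_B(t):=\sum_{k=0}^\infty \frac{t^{2k}}{(2k)!}B^k$. Dots denote derivatives with respect to the curve parameter $t$; primes denote derivatives with respect to $s$. $J_m(\lambda)$ is the $m\times m$ Jordan block with $\lambda$ on the diagonal and $1$ on the superdiagonal. *)

theory Defs
  imports
    "Jordan_Normal_Form.Jordan_Normal_Form_Existence"
    "HOL-Analysis.Analysis"
begin

hide_const (open) Matrix.mat Matrix.vec Matrix.row Determinant.det
no_notation vec_index (infixl \<open>$\<close> 100)

text \<open>At a point where some derivative of order below \<open>k\<close> fails to exist, \<open>nth_vderiv k\<close> is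
  unspecified; it is only used for functions that are \<open>smooth_on\<close> an open set containing the point.\<close>

definition nth_vderiv :: "nat \<Rightarrow> (real \<Rightarrow> 'a::real_normed_vector) \<Rightarrow> real \<Rightarrow> 'a" where
  "nth_vderiv k f = ((\<lambda>g t. vector_derivative g (at t)) ^^ k) f"

text \<open>Intended for open \<open>S\<close>: the derivatives are two-sided.\<close>

definition smooth_on :: "real set \<Rightarrow> (real \<Rightarrow> 'a::real_normed_vector) \<Rightarrow> bool" where
  "smooth_on S f \<longleftrightarrow> (\<forall>k. \<forall>t\<in>S. nth_vderiv k f differentiable (at t))"

definition curve_average :: "(real \<Rightarrow> 'a::real_vector) \<Rightarrow> real \<Rightarrow> real \<Rightarrow> 'a" where
  "curve_average c s t = (1/4) *\<^sub>R (c (t - s) + 2 *\<^sub>R c t + c (t + s))"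

definition solves_ivp ::
  "real^'n^'n \<Rightarrow> real^'n \<Rightarrow> real^'n \<Rightarrow> real^'n \<Rightarrow> (real \<Rightarrow> real^'n) \<Rightarrow> bool" where
  "solves_ivp B d v w f \<longleftrightarrow>
    (\<exists>f'. (\<forall>t. (f has_vector_derivative f' t) (at t)) \<and>
          (\<forall>t. (f' has_vector_derivative (B *v f t + d)) (at t)) \<and>
          f 0 = v \<and> f' 0 = w)"

text \<open>The operations \<open>*\<close>, \<open>1\<close> of the type \<^typ>\<open>real^'n^'n\<close> are entrywise, so matrix powers are
  iterates of \<open>**\<close>.\<close>

definition matpow :: "real^'n^'n \<Rightarrow> nat \<Rightarrow> real^'n^'n" where
  "matpow B k = (((**) B) ^^ k) (mat 1)"

definition co :: "real^'n^'n \<Rightarrow> real \<Rightarrow> real^'n^'n" where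
  "co B t = (\<Sum>k. (t ^ (2 * k) / fact (2 * k)) *\<^sub>R matpow B k)"

text \<open>A real matrix with rows and columns indexed by the type \<open>'n\<close>, as a complex matrix indexed by
  \<open>{0..<CARD('n)}\<close>. The enumeration of \<open>'n\<close> is immaterial: another one gives a similar matrix.\<close>

definition complex_mat :: "real^'n^'n \<Rightarrow> complex Matrix.mat" where
  "complex_mat A = Matrix.mat CARD('n) CARD('n)
     (\<lambda>(i, j). complex_of_real (A $ from_nat_into UNIV i $ from_nat_into UNIV j))"

end

theory Submission
  imports "Jordan_Normal_Form.Jordan_Normal_Form_Uniqueness" Defs
begin

text \<open>
  The theorem comes from differentiating the hypothesis \<open>c\<^sub>s(t) = A(s) c(t) + b(s)\<close>. Because the first
  \<open>n\<close> derivatives of \<open>c\<close> at \<open>t\<^sub>0\<close> span the space, an affine map is determined by its values along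
  the curve (\<open>affine_maps_equal_on_curve\<close>). So any identity \<open>M c(t) + m = N c(t) + n\<close> valid for all \<open>t\<close>
  yields \<open>M = N\<close> and \<open>m = n\<close>.

  At \<open>s = 0\<close> the hypothesis itself and its first derivative in \<open>s\<close> give the initial values of \<open>A\<close> and
  \<open>b\<close>. The second derivative in \<open>s\<close> reads
  \<open>(c''(t + s) + c''(t - s))/4 = A''(s) c(t) + b''(s)\<close>, which at \<open>s = 0\<close> is \<open>c'' = B c + d\<close>. The second
  derivative in \<open>t\<close> shows that the same left-hand side equals \<open>(A(s) - 1/2) c''(t)\<close>, that is
  \<open>(A(s) - 1/2)(B c(t) + d)\<close>; comparing coefficients gives the equations for \<open>A\<close> and \<open>b\<close>. Uniqueness
  of the solutions of linear second-order equations (\<open>linear_second_order_ode_zero\<close>) then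
  characterizes \<open>c\<close> and identifies \<open>A(s)\<close> with \<open>(1 + co\<^sub>B(s))/2\<close>.

  For the Jordan blocks, the double-angle formula (\<open>co_double\<close>), again a consequence of uniqueness,
  turns this into \<open>A(s) = co\<^sub>B(s/2)\<^sup>2\<close>, the square of a real matrix \<open>C\<close>. A negative eigenvalue \<open>\<lambda>\<close> of \<open>C\<^sup>2\<close>
  comes from the two eigenvalues \<open>\<plusminus>\<i>\<surd>-\<lambda>\<close> of \<open>C\<close>, which complex conjugation exchanges. So
  \<open>ker (C\<^sup>2 - \<lambda>)\<^sup>k\<close> has even dimension for every \<open>k\<close>, and these dimensions determine the numbers of
  Jordan blocks (\<open>even_jordan_blocks_square\<close>).
\<close>

no_notation vec_index (infixl \<open>$\<close> 100)
no_notation Matrix.scalar_prod (infix \<open>\<bullet>\<close> 70)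

section \<open>Derivatives and linearity\<close>

lemma nth_vderiv_0 [simp]: "nth_vderiv 0 f = f"
  by (simp add: nth_vderiv_def)

lemma smooth_on_has_vector_derivative:
  assumes "smooth_on S f" "t \<in> S"
  shows "(nth_vderiv k f has_vector_derivative nth_vderiv (Suc k) f t) (at t)"
  using assms vector_derivative_works[of "nth_vderiv k f" "at t"]
  by (simp add: smooth_on_def nth_vderiv_def)

lemma has_vector_derivative_translate:
  assumes "(f has_vector_derivative f') (at (a + x))"
  shows "((\<lambda>x. f (a + x)) has_vector_derivative f') (at x)"
    and "((\<lambda>x. f (x + a)) has_vector_derivative f') (at x)"
proof -
  have "((+) a has_vector_derivative 1) (at x)"
    by (auto intro!: derivative_eq_intros)
  from vector_diff_chain_at[OF this assms]
  show "((\<lambda>x. f (a + x)) has_vector_derivative f') (at x)" by (simp add: o_def)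
  thus "((\<lambda>x. f (x + a)) has_vector_derivative f') (at x)" by (simp only: add.commute)
qed

lemma has_vector_derivative_reflect:
  assumes "(f has_vector_derivative f') (at (t - s))"
  shows "((\<lambda>s. f (t - s)) has_vector_derivative - f') (at s)"
proof -
  have "((\<lambda>s. t - s) has_vector_derivative - 1) (at s)"
    by (auto intro!: derivative_eq_intros)
  from vector_diff_chain_at[OF this assms] show ?thesis by (simp add: o_def)
qed

lemma bounded_linear_matrix_mult_left: "bounded_linear (\<lambda>X::real^'n^'n. M ** X)"
  by (intro linear_conv_bounded_linear[THEN iffD1] linearI)
     (simp_all add: vec_eq_iff matrix_matrix_mult_def sum_distrib_left sum.distrib algebra_simps)

lemma bounded_linear_matrix_mult_right: "bounded_linear (\<lambda>X::real^'n^'n. X ** M)"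
  by (intro linear_conv_bounded_linear[THEN iffD1] linearI)
     (simp_all add: vec_eq_iff matrix_matrix_mult_def sum_distrib_left sum.distrib algebra_simps)

lemma bounded_linear_matrix_vector_mult_left: "bounded_linear (\<lambda>X::real^'n^'n. X *v v)"
  by (intro linear_conv_bounded_linear[THEN iffD1] linearI)
     (simp_all add: vec_eq_iff matrix_vector_mult_def sum_distrib_left sum.distrib algebra_simps)

lemmas matrix_mult_linear_simps =
  linear_0[OF bounded_linear.linear[OF bounded_linear_matrix_mult_left]]
  linear_0[OF bounded_linear.linear[OF bounded_linear_matrix_mult_right]]
  linear_add[OF bounded_linear.linear[OF bounded_linear_matrix_mult_left]]
  linear_add[OF bounded_linear.linear[OF bounded_linear_matrix_mult_right]]
  linear_diff[OF bounded_linear.linear[OF bounded_linear_matrix_mult_left]]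
  linear_diff[OF bounded_linear.linear[OF bounded_linear_matrix_mult_right]]
  linear_scale[OF bounded_linear.linear[OF bounded_linear_matrix_mult_left]]
  linear_scale[OF bounded_linear.linear[OF bounded_linear_matrix_mult_right]]

section \<open>Uniqueness for linear second-order equations\<close>

text \<open>The energy \<open>E = \<bar>g\<bar>\<^sup>2 + \<bar>h\<bar>\<^sup>2\<close> with \<open>h = g'\<close> satisfies \<open>E' \<le> (1 + K) E\<close>, where \<open>K\<close> bounds the operator
  \<open>L\<close>: both terms of \<open>E' = 2 \<langle>g, h\<rangle> + 2 \<langle>h, L g\<rangle>\<close> are controlled by \<open>2 \<bar>g\<bar> \<bar>h\<bar> \<le> E\<close>. Hence
  \<open>E(t) exp(-(1 + K) t)\<close> does not increase, and it starts at zero. This is Gronwall's argument, stated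
  forward in time only.\<close>

lemma linear_second_order_ode_zero_forward:
  fixes g h :: "real \<Rightarrow> 'a::real_inner"
  assumes L: "bounded_linear L"
    and g: "\<And>t. t \<in> {0..r} \<Longrightarrow> (g has_vector_derivative h t) (at t)"
    and h: "\<And>t. t \<in> {0..r} \<Longrightarrow> (h has_vector_derivative L (g t)) (at t)"
    and init: "g 0 = 0" "h 0 = 0" and r: "0 \<le> r"
  shows "g r = 0"
proof -
  obtain K where K: "K \<ge> 0" "\<And>x. norm (L x) \<le> norm x * K"
    using bounded_linear.nonneg_bounded[OF L] by blast
  define E where "E = (\<lambda>t. g t \<bullet> g t + h t \<bullet> h t)"
  define F where "F = (\<lambda>t. E t * exp (- (1 + K) * t))"
  have "F r \<le> F 0"
  proof (rule DERIV_nonpos_imp_nonincreasing[OF r], goal_cases)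
    case (1 t)
    hence t: "t \<in> {0..r}" by simp
    define E' where "E' = 2 * (g t \<bullet> h t) + 2 * (h t \<bullet> L (g t))"
    have "(E has_vector_derivative E') (at t)"
      unfolding E_def E'_def
      by (rule derivative_eq_intros bounded_bilinear.has_vector_derivative[OF bounded_bilinear_inner]
          g[OF t] h[OF t])+ (simp add: inner_commute)
    hence E: "(E has_real_derivative E') (at t)"
      by (simp add: has_real_derivative_iff_has_vector_derivative)
    have F: "(F has_real_derivative (E' - (1 + K) * E t) * exp (- (1 + K) * t)) (at t)"
      unfolding F_def by (rule derivative_eq_intros E refl)+ (simp add: algebra_simps)
    have young: "2 * (norm x * norm y) \<le> x \<bullet> x + y \<bullet> y" for x y :: 'a
      using sum_squares_bound[of "norm x" "norm y"]
      by (simp add: power2_norm_eq_inner mult.assoc)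
    have "2 * (g t \<bullet> h t) \<le> E t"
      using norm_cauchy_schwarz[of "g t" "h t"] young[of "g t" "h t"] unfolding E_def by linarith
    moreover have "2 * (h t \<bullet> L (g t)) \<le> K * E t"
    proof -
      have "h t \<bullet> L (g t) \<le> norm (h t) * norm (L (g t))" by (rule norm_cauchy_schwarz)
      also have "\<dots> \<le> norm (h t) * (norm (g t) * K)" by (intro mult_left_mono K) simp
      finally have "2 * (h t \<bullet> L (g t)) \<le> K * (2 * (norm (g t) * norm (h t)))"
        by (simp add: algebra_simps)
      also have "\<dots> \<le> K * E t" unfolding E_def by (intro mult_left_mono young K)
      finally show ?thesis .
    qed
    ultimately have "E' - (1 + K) * E t \<le> 0"
      unfolding E'_def by (simp add: algebra_simps)
    thus ?case using F by (meson mult_nonpos_nonneg exp_ge_zero)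
  qed
  also have "F 0 = 0" by (simp add: F_def E_def init)
  finally have "E r \<le> 0"
    by (simp add: F_def mult_le_0_iff)
  hence "g r \<bullet> g r \<le> 0" using inner_ge_zero[of "h r"] unfolding E_def by linarith
  thus ?thesis using inner_eq_zero_iff inner_ge_zero order_antisym by blast
qed

text \<open>Negative times reduce to positive ones because the equation has even order: \<open>t \<mapsto> g(-t)\<close> solves it
  too, with velocity \<open>t \<mapsto> -h(-t)\<close>. The interval \<open>S\<close> allows for families that are smooth near \<open>0\<close>
  only.\<close>

lemma linear_second_order_ode_zero:
  fixes g h :: "real \<Rightarrow> 'a::real_inner"
  assumes L: "bounded_linear L" and S: "is_interval S" "0 \<in> S"
    and g: "\<And>t. t \<in> S \<Longrightarrow> (g has_vector_derivative h t) (at t)"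
    and h: "\<And>t. t \<in> S \<Longrightarrow> (h has_vector_derivative L (g t)) (at t)"
    and init: "g 0 = 0" "h 0 = 0" and r: "r \<in> S"
  shows "g r = 0"
proof (cases "0 \<le> r")
  case True
  hence "{0..r} \<subseteq> S" using mem_is_interval_1_I[OF S r] by auto
  thus ?thesis by (intro linear_second_order_ode_zero_forward[OF L, of r g h]) (auto intro: g h init True)
next
  case False
  have sub: "- t \<in> S" if "t \<in> {0..-r}" for t
    using S r that False mem_is_interval_1_I[of S r 0 "-t"] by auto
  have "(\<lambda>t. g (- t)) (- r) = 0"
  proof (rule linear_second_order_ode_zero_forward[OF L, of "- r" _ "\<lambda>t. - h (- t)"])
    fix t assume "t \<in> {0..-r}"
    hence t: "- t \<in> S" by (rule sub)
    show "((\<lambda>t. g (- t)) has_vector_derivative - h (- t)) (at t)"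
      using has_vector_derivative_reflect[of g _ 0 t] g[OF t] by simp
    have "((\<lambda>t. h (- t)) has_vector_derivative - L (g (- t))) (at t)"
      using has_vector_derivative_reflect[of h _ 0 t] h[OF t] by simp
    from has_vector_derivative_minus[OF this]
    show "((\<lambda>t. - h (- t)) has_vector_derivative L (g (- t))) (at t)" by simp
  qed (use False init in auto)
  thus ?thesis by simp
qed

section \<open>The matrix cosine series\<close>

text \<open>Lets results about scalar power series be used entry by entry for vectors, and twice in succession
  for matrices.\<close>

lemma has_vector_derivative_vec_componentwise:
  fixes f :: "real \<Rightarrow> ('a::euclidean_space)^'n"
  assumes "\<And>i. ((\<lambda>t. f t $ i) has_vector_derivative f' $ i) (at x)"
  shows "(f has_vector_derivative f') (at x)"
proof -
  have "((\<lambda>t. f t $ i \<bullet> b) has_vector_derivative f' $ i \<bullet> b) (at x)" for i b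
    by (rule bounded_linear.has_vector_derivative[OF bounded_linear_inner_left assms])
  hence "((\<lambda>t. f t \<bullet> b) has_vector_derivative f' \<bullet> b) (at x)" if "b \<in> Basis" for b
    using that by (auto simp: Basis_vec_def inner_axis inner_commute)
  thus ?thesis
    unfolding has_vector_derivative_def
    by (subst has_derivative_componentwise_within) (simp add: inner_scaleR_left)
qed

lemma matpow_0 [simp]: "matpow B 0 = mat 1"
  by (simp add: matpow_def)

lemma matpow_Suc: "matpow B (Suc k) = B ** matpow B k"
  by (simp add: matpow_def)

text \<open>The coefficients of \<open>co B\<close> as an ordinary power series in \<open>t\<close>, zeros in odd degrees included, so
  that termwise differentiation of power series applies.\<close>

definition co_coeff :: "real^'n^'n \<Rightarrow> nat \<Rightarrow> real^'n^'n" where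
  "co_coeff B n = (if even n then (1 / fact n) *\<^sub>R matpow B (n div 2) else 0)"

text \<open>The recursion that makes \<open>co B\<close> a solution of \<open>X'' = B X\<close>.\<close>

lemma co_coeff_step: "(real (Suc n) * real (Suc (Suc n))) *\<^sub>R co_coeff B (Suc (Suc n)) = B ** co_coeff B n"
proof -
  have "(real (Suc n) * real (Suc (Suc n))) * (1 / fact (Suc (Suc n))) = 1 / fact n"
    by (simp add: divide_simps)
  thus ?thesis
    unfolding co_coeff_def
    by (simp add: matrix_mult_linear_simps matpow_Suc del: fact_Suc of_nat_Suc)
qed

text \<open>Choosing \<open>K \<ge> 1\<close> makes \<open>K\<^sup>k \<le> K\<^sup>2\<^sup>k\<close>, so that the even-degree series below is dominated by an
  exponential series.\<close>

lemma norm_matpow_le: "\<exists>K\<ge>1. \<forall>k. norm (matpow B k) \<le> norm (mat 1 :: real^'n^'n) * K ^ k" for B :: "real^'n^'n"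
proof -
  obtain K where "K \<ge> 0 \<and> (\<forall>X::real^'n^'n. norm (B ** X) \<le> norm X * K)"
    using bounded_linear.nonneg_bounded[OF bounded_linear_matrix_mult_left[of B]] ..
  hence K: "norm (B ** X) \<le> norm X * K" for X :: "real^'n^'n" by simp
  have "norm (matpow B k) \<le> norm (mat 1 :: real^'n^'n) * (max 1 K) ^ k" for k
  proof (induction k)
    case (Suc k)
    have "norm (matpow B (Suc k)) \<le> norm (matpow B k) * max 1 K"
      unfolding matpow_Suc by (rule order_trans[OF K]) (simp add: mult_left_mono)
    also have "\<dots> \<le> (norm (mat 1 :: real^'n^'n) * (max 1 K) ^ k) * max 1 K"
      using Suc by (intro mult_right_mono) auto
    finally show ?case by (simp add: mult_ac)
  qed simp
  thus ?thesis by (intro exI[of _ "max 1 K"]) auto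
qed

lemma summable_co_coeff: "summable (\<lambda>n. t ^ n *\<^sub>R co_coeff B n)" for B :: "real^'n^'n"
proof -
  let ?c = "norm (mat 1 :: real^'n^'n)"
  obtain K where K: "K \<ge> 1" "\<And>k. norm (matpow B k) \<le> ?c * K ^ k"
    using norm_matpow_le[of B] by blast
  show ?thesis
  proof (rule summable_comparison_test')
    show "summable (\<lambda>n. ?c * (inverse (fact n) * (K * \<bar>t\<bar>) ^ n))"
      by (intro summable_mult summable_exp)
    fix n :: nat
    have "norm (co_coeff B n) \<le> ?c * K ^ n / fact n"
    proof (cases "even n")
      case True
      have "norm (matpow B (n div 2)) \<le> ?c * K ^ (n div 2)" by (rule K)
      also have "\<dots> \<le> ?c * K ^ n" using K(1) by (intro mult_left_mono power_increasing) auto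
      finally show ?thesis using True by (simp add: co_coeff_def divide_right_mono)
    qed (use K(1) in \<open>simp add: co_coeff_def\<close>)
    hence "\<bar>t\<bar> ^ n * norm (co_coeff B n) \<le> \<bar>t\<bar> ^ n * (?c * K ^ n / fact n)"
      by (intro mult_left_mono) auto
    thus "norm (t ^ n *\<^sub>R co_coeff B n) \<le> ?c * (inverse (fact n) * (K * \<bar>t\<bar>) ^ n)"
      by (simp add: power_abs power_mult_distrib field_simps)
  qed
qed

lemma co_sums: "(\<lambda>n. t ^ n *\<^sub>R co_coeff B n) sums co B t"
proof -
  let ?f = "\<lambda>n. t ^ n *\<^sub>R co_coeff B n"
  have "strict_mono (\<lambda>k::nat. 2 * k)" by (rule strict_monoI) simp
  moreover have "?f n = 0" if "n \<notin> range (\<lambda>k::nat. 2 * k)" for n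
    using that by (auto simp: co_coeff_def elim!: evenE)
  moreover have "?f (2 * k) = (t ^ (2 * k) / fact (2 * k)) *\<^sub>R matpow B k" for k
    by (simp add: co_coeff_def)
  ultimately have "co B t = (\<Sum>n. ?f n)"
    unfolding co_def using suminf_mono_reindex[of "\<lambda>k. 2 * k" ?f] by simp
  thus ?thesis using summable_sums[OF summable_co_coeff] by simp
qed

definition co_deriv :: "real^'n^'n \<Rightarrow> real \<Rightarrow> real^'n^'n" where
  "co_deriv B t = (\<chi> i j. \<Sum>n. diffs (\<lambda>n. co_coeff B n $ i $ j) n * t ^ n)"

lemma co_nth: "(\<lambda>n. co_coeff B n $ i $ j * t ^ n) sums (co B t $ i $ j)"
  using bounded_linear.sums[OF bounded_linear_compose[OF bounded_linear_vec_nth bounded_linear_vec_nth] co_sums]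
  by (simp add: mult_ac)

lemma co_nth_eq: "co B t $ i $ j = (\<Sum>n. co_coeff B n $ i $ j * t ^ n)"
  by (rule sums_unique[OF co_nth])

lemma co_nth_summable: "summable (\<lambda>n. co_coeff B n $ i $ j * t ^ n)"
  by (rule sums_summable[OF co_nth])

lemma co_has_vector_derivative: "(co B has_vector_derivative co_deriv B t) (at t)"
proof (intro has_vector_derivative_vec_componentwise)
  fix i j
  show "((\<lambda>t. co B t $ i $ j) has_vector_derivative co_deriv B t $ i $ j) (at t)"
    unfolding co_nth_eq co_deriv_def
    using termdiffs_strong_converges_everywhere[of "\<lambda>n. co_coeff B n $ i $ j", OF co_nth_summable]
    by (simp add: has_real_derivative_iff_has_vector_derivative)
qed

lemma co_deriv_has_vector_derivative: "(co_deriv B has_vector_derivative B ** co B t) (at t)"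
proof (intro has_vector_derivative_vec_componentwise)
  fix i j
  let ?a = "\<lambda>n. co_coeff B n $ i $ j"
  have "diffs (diffs ?a) n = (B ** co_coeff B n) $ i $ j" for n
    by (simp add: diffs_def flip: co_coeff_step)
  moreover have "(\<lambda>n. (B ** (t ^ n *\<^sub>R co_coeff B n)) $ i $ j) sums ((B ** co B t) $ i $ j)"
    by (intro bounded_linear.sums[OF bounded_linear_vec_nth] bounded_linear.sums[OF bounded_linear_matrix_mult_left] co_sums)
  hence "(\<lambda>n. (B ** co_coeff B n) $ i $ j * t ^ n) sums ((B ** co B t) $ i $ j)"
    by (simp add: matrix_mult_linear_simps mult_ac)
  ultimately have eq: "(\<Sum>n. diffs (diffs ?a) n * t ^ n) = (B ** co B t) $ i $ j"
    by (simp add: sums_iff)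
  have "((\<lambda>t. \<Sum>n. diffs ?a n * t ^ n) has_field_derivative (\<Sum>n. diffs (diffs ?a) n * t ^ n)) (at t)"
    by (intro termdiffs_strong_converges_everywhere) (rule termdiff_converges_all[OF co_nth_summable])
  thus "((\<lambda>t. co_deriv B t $ i $ j) has_vector_derivative (B ** co B t) $ i $ j) (at t)"
    unfolding eq co_deriv_def by (simp add: has_real_derivative_iff_has_vector_derivative)
qed

lemma co_0 [simp]: "co B 0 = mat 1"
proof -
  have "co B 0 $ i $ j = co_coeff B 0 $ i $ j" for i j
    unfolding co_nth_eq by simp
  thus ?thesis by (simp add: vec_eq_iff co_coeff_def)
qed

lemma co_even [simp]: "co B (- t) = co B t"
  by (simp add: co_def)

lemma co_deriv_odd: "co_deriv B (- t) = - co_deriv B t"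
proof -
  have "(co B has_vector_derivative - co_deriv B (- t)) (at t)"
    using has_vector_derivative_reflect[of "co B" _ 0 t] co_has_vector_derivative[of B "- t"] by simp
  from vector_derivative_unique_at[OF this co_has_vector_derivative]
  show ?thesis by (metis minus_minus)
qed

lemma co_deriv_0: "co_deriv B 0 = 0"
  using co_deriv_odd[of B 0] by (simp add: vec_eq_iff)

lemma co_commute: "co B t ** B = B ** co B t"
proof -
  have m: "co_coeff B n ** B = B ** co_coeff B n" for n
  proof -
    have "matpow B k ** B = B ** matpow B k" for k
      by (induction k) (simp_all add: matpow_Suc flip: matrix_mul_assoc)
    thus ?thesis
      by (simp add: co_coeff_def matrix_mult_linear_simps)
  qed
  have "(\<lambda>n. (t ^ n *\<^sub>R co_coeff B n) ** B) sums (co B t ** B)"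
    by (rule bounded_linear.sums[OF bounded_linear_matrix_mult_right co_sums])
  moreover have "(\<lambda>n. B ** (t ^ n *\<^sub>R co_coeff B n)) sums (B ** co B t)"
    by (rule bounded_linear.sums[OF bounded_linear_matrix_mult_left co_sums])
  ultimately show ?thesis
    by (simp add: matrix_mult_linear_simps m sums_unique2)
qed

text \<open>Both sides of the addition formula \<open>co(s + t) + co(-s + t) = 2 co(t) co(s)\<close>, as functions of \<open>t\<close>, solve
  \<open>X'' = B X\<close> with value \<open>2 co(s)\<close> and velocity \<open>0\<close> at \<open>t = 0\<close>, the velocity because \<open>co\<close> is even. So
  they agree, and \<open>t = s\<close> is the claim.\<close>

lemma co_double: "co B (2 * s) = 2 *\<^sub>R (co B s ** co B s) - mat 1"
proof -
  (* the difference of the two sides of the addition formula, and its derivative *)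
  define g where "g = (\<lambda>t. co B (s + t) + co B (- s + t) - 2 *\<^sub>R (co B t ** co B s))"
  define h where "h = (\<lambda>t. co_deriv B (s + t) + co_deriv B (- s + t) - 2 *\<^sub>R (co_deriv B t ** co B s))"
  note lin = bounded_linear.has_vector_derivative[OF bounded_linear_matrix_mult_right]
    bounded_linear.has_vector_derivative[OF bounded_linear_scaleR_right]
  have "g s = 0"
  proof (rule linear_second_order_ode_zero[OF bounded_linear_matrix_mult_left[of B], of UNIV g h])
    fix t
    show "(g has_vector_derivative h t) (at t)"
      unfolding g_def h_def
      by (intro has_vector_derivative_add has_vector_derivative_diff lin
          has_vector_derivative_translate co_has_vector_derivative)
    have "B ** g t = B ** co B (s + t) + B ** co B (- s + t) - 2 *\<^sub>R ((B ** co B t) ** co B s)"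
      by (simp add: g_def matrix_mult_linear_simps matrix_mul_assoc)
    thus "(h has_vector_derivative B ** g t) (at t)"
      unfolding h_def
      by (simp only:) (intro has_vector_derivative_add has_vector_derivative_diff lin
          has_vector_derivative_translate co_deriv_has_vector_derivative)
  next
    show "h 0 = 0" 
      using co_deriv_odd[of B s]
      by (simp add: h_def co_deriv_0 matrix_mult_linear_simps)
    show "g 0 = 0" by (simp add: g_def scaleR_2)
  qed auto
  thus ?thesis by (simp add: g_def algebra_simps)
qed

section \<open>Averages of a curve and comparison of coefficients\<close>

lemma curve_average_deriv_time:
  assumes "\<And>x. (f has_vector_derivative f' x) (at x)"
  shows "((\<lambda>t. curve_average f s t) has_vector_derivative curve_average f' s t) (at t)"
proof -
  have "((\<lambda>t. f (t + - s)) has_vector_derivative f' (- s + t)) (at t)"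
    "((\<lambda>t. f (t + s)) has_vector_derivative f' (s + t)) (at t)"
    by (intro has_vector_derivative_translate assms)+
  thus ?thesis
    unfolding curve_average_def
    by (intro bounded_linear.has_vector_derivative[OF bounded_linear_scaleR_right]
        has_vector_derivative_add assms) (simp_all add: add.commute)
qed

lemma has_vector_derivative_shift_param:
  assumes "\<And>x. (f has_vector_derivative f' x) (at x)"
  shows "((\<lambda>s. f (t + s)) has_vector_derivative f' (t + s)) (at s)"
    and "((\<lambda>s. f (t - s)) has_vector_derivative - f' (t - s)) (at s)"
  by (intro has_vector_derivative_translate has_vector_derivative_reflect assms)+

lemma curve_average_deriv_param:
  assumes "\<And>x. (f has_vector_derivative f' x) (at x)"
  shows "((\<lambda>s. curve_average f s t) has_vector_derivative (1/4) *\<^sub>R (f' (t + s) - f' (t - s))) (at s)"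
proof -
  note sum = has_vector_derivative_add[OF
      has_vector_derivative_add[OF has_vector_derivative_shift_param(2)[OF assms, of t s]
        has_vector_derivative_const[of "2 *\<^sub>R f t"]]
      has_vector_derivative_shift_param(1)[OF assms]]
  show ?thesis
    using bounded_linear.has_vector_derivative[OF bounded_linear_scaleR_right sum, of "1/4"]
    by (simp add: curve_average_def)
qed

lemma curve_average_deriv_param2:
  assumes "\<And>x. (f has_vector_derivative f' x) (at x)"
  shows "((\<lambda>s. (1/4) *\<^sub>R (f (t + s) - f (t - s))) has_vector_derivative (1/4) *\<^sub>R (f' (t + s) + f' (t - s))) (at s)"
proof -
  note diff = has_vector_derivative_diff[OF has_vector_derivative_shift_param[OF assms, of t s]]
  show ?thesis
    using bounded_linear.has_vector_derivative[OF bounded_linear_scaleR_right diff, of "1/4"] by simp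
qed

text \<open>Differentiating \<open>M c(t) + m = 0\<close> repeatedly gives \<open>M c\<^sup>(\<^sup>k\<^sup>)(t) = 0\<close> for all \<open>k \<ge> 1\<close>; at \<open>t\<^sub>0\<close> the first \<open>n\<close> of these
  derivatives are a basis, so \<open>M\<close> is zero and then \<open>m\<close> is.\<close>

lemma affine_map_vanishing_on_curve:
  fixes c :: "real \<Rightarrow> real^'n" and M :: "real^'n^'n"
  assumes c_smooth: "smooth_on UNIV c"
    and inj: "inj_on (\<lambda>k. nth_vderiv k c t\<^sub>0) {1..CARD('n)}"
    and indep: "independent ((\<lambda>k. nth_vderiv k c t\<^sub>0) ` {1..CARD('n)})"
    and zero: "\<And>t. M *v c t + m = 0"
  shows "M = 0" and "m = 0"
proof -
  let ?X = "(\<lambda>k. nth_vderiv k c t\<^sub>0) ` {1..CARD('n)}"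
  have dM: "((\<lambda>t. M *v nth_vderiv k c t) has_vector_derivative M *v nth_vderiv (Suc k) c t) (at t)" for k t
    by (intro bounded_linear.has_vector_derivative[OF matrix_vector_mul_bounded_linear]
        smooth_on_has_vector_derivative[OF c_smooth] UNIV_I)
  have step: "M *v nth_vderiv (Suc k) c t = 0" if "\<And>t. M *v nth_vderiv k c t + x = 0" for k t x
  proof -
    have "((\<lambda>t. M *v nth_vderiv k c t + x) has_vector_derivative M *v nth_vderiv (Suc k) c t + 0) (at t)"
      by (intro has_vector_derivative_add dM has_vector_derivative_const)
    hence "((\<lambda>t. 0) has_vector_derivative M *v nth_vderiv (Suc k) c t) (at t)"
      by (simp add: that)
    thus ?thesis
      using vector_derivative_unique_at has_vector_derivative_const by blast
  qed
  have derivs: "M *v nth_vderiv (Suc k) c t = 0" for k t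
  proof (induction k arbitrary: t)
    case 0
    show ?case by (rule step[of 0 m]) (simp add: zero)
  next
    case (Suc k)
    show ?case by (rule step[of _ 0]) (simp add: Suc)
  qed
  have on_X: "M *v x = 0" if "x \<in> ?X" for x
  proof -
    obtain k where "k \<in> {1..CARD('n)}" "x = nth_vderiv k c t\<^sub>0" using \<open>x \<in> ?X\<close> by blast
    thus ?thesis using derivs[of "k - 1" t\<^sub>0] by simp
  qed
  have "card ?X = CARD('n)" using card_image[OF inj] by simp
  hence "UNIV \<subseteq> span ?X"
    by (intro card_ge_dim_independent indep) simp_all
  hence "M *v x = 0" for x
    using linear_eq_0_on_span[OF matrix_vector_mul_linear on_X] by (meson UNIV_I subsetD)
  thus M: "M = 0" by (simp add: matrix_eq)
  show "m = 0" using zero M by simp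
qed

text \<open>This is how identities along the curve become identities between the coefficients.\<close>

lemma affine_maps_equal_on_curve:
  fixes c :: "real \<Rightarrow> real^'n" and M N :: "real^'n^'n"
  assumes c_smooth: "smooth_on UNIV c"
    and inj: "inj_on (\<lambda>k. nth_vderiv k c t\<^sub>0) {1..CARD('n)}"
    and indep: "independent ((\<lambda>k. nth_vderiv k c t\<^sub>0) ` {1..CARD('n)})"
    and eq: "\<And>t. M *v c t + m = N *v c t + n"
  shows "M = N \<and> m = n"
proof -
  have "(M - N) *v c t + (m - n) = 0" for t
    using eq[of t] by (simp add: matrix_vector_mult_diff_rdistrib algebra_simps)
  from affine_map_vanishing_on_curve[OF c_smooth inj indep this] show ?thesis by simp
qed

text \<open>The inhomogeneity cancels in the difference of two solutions.\<close>

lemma ivp_solution_unique: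
  assumes f: "solves_ivp B d v w f" and g: "solves_ivp B d v w g"
  shows "f = g"
proof
  fix r
  from f obtain f' where f': "\<And>t. (f has_vector_derivative f' t) (at t)"
    "\<And>t. (f' has_vector_derivative B *v f t + d) (at t)" "f 0 = v" "f' 0 = w"
    unfolding solves_ivp_def by blast
  from g obtain g' where g': "\<And>t. (g has_vector_derivative g' t) (at t)"
    "\<And>t. (g' has_vector_derivative B *v g t + d) (at t)" "g 0 = v" "g' 0 = w"
    unfolding solves_ivp_def by blast
  have "f r - g r = 0"
  proof (rule linear_second_order_ode_zero[of "(*v) B" UNIV "\<lambda>t. f t - g t" "\<lambda>t. f' t - g' t"])
    fix t
    show "((\<lambda>t. f t - g t) has_vector_derivative f' t - g' t) (at t)"
      by (intro has_vector_derivative_diff f' g')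
    have "((\<lambda>t. f' t - g' t) has_vector_derivative (B *v f t + d) - (B *v g t + d)) (at t)"
      by (intro has_vector_derivative_diff f' g')
    thus "((\<lambda>t. f' t - g' t) has_vector_derivative B *v (f t - g t)) (at t)"
      by (simp add: matrix_vector_mult_diff_distrib)
  qed (simp_all add: f' g' matrix_vector_mul_bounded_linear)
  thus "f r = g r" by simp
qed

text \<open>The right-hand side solves the same initial value problem. Here \<open>B\<close> multiplies from the right,
  whereas \<open>co B\<close> was differentiated with \<open>B\<close> on the left; the two agree as \<open>B\<close> commutes with \<open>co B\<close>.\<close>

lemma matrix_ode_solution_co:
  fixes A :: "real \<Rightarrow> real^'n^'n"
  assumes S: "is_interval S" "0 \<in> S"
    and A: "\<And>s. s \<in> S \<Longrightarrow> (A has_vector_derivative A' s) (at s)"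
    and A': "\<And>s. s \<in> S \<Longrightarrow> (A' has_vector_derivative (A s - (1/2) *\<^sub>R mat 1) ** B) (at s)"
    and init: "A 0 = mat 1" "A' 0 = 0" and s: "s \<in> S"
  shows "A s = (1/2) *\<^sub>R (mat 1 + co B s)"
proof -
  let ?g = "\<lambda>s. A s - (1/2) *\<^sub>R (mat 1 + co B s)"
  let ?h = "\<lambda>s. A' s - (1/2) *\<^sub>R (0 + co_deriv B s)"
  note lin = bounded_linear.has_vector_derivative[OF bounded_linear_scaleR_right]
  have "?g s = 0"
  proof (rule linear_second_order_ode_zero[OF bounded_linear_matrix_mult_right[of B] S, of ?g ?h])
    fix t assume t: "t \<in> S"
    show "(?g has_vector_derivative ?h t) (at t)"
      by (intro has_vector_derivative_diff A[OF t] lin has_vector_derivative_add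
          has_vector_derivative_const co_has_vector_derivative)
    have "(?h has_vector_derivative (A t - (1/2) *\<^sub>R mat 1) ** B - (1/2) *\<^sub>R (0 + B ** co B t)) (at t)"
      by (intro has_vector_derivative_diff A'[OF t] lin has_vector_derivative_add
          has_vector_derivative_const co_deriv_has_vector_derivative)
    moreover have "(A t - (1/2) *\<^sub>R mat 1) ** B - (1/2) *\<^sub>R (0 + B ** co B t) = ?g t ** B"
      by (simp add: matrix_mult_linear_simps co_commute algebra_simps)
    ultimately show "(?h has_vector_derivative ?g t ** B) (at t)" by simp
  next
    show "?g 0 = 0" "?h 0 = 0" by (simp_all add: init co_deriv_0 flip: scaleR_2)
  qed (rule s)
  thus ?thesis by simp
qed

section \<open>Jordan blocks of squares of real matrices\<close>

lemma kernel_dim_mult_left_nonsingular: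
  fixes A B :: "'a::field Matrix.mat"
  assumes A: "A \<in> carrier_mat n n" and B: "B \<in> carrier_mat n n" and d: "Determinant.det B \<noteq> 0"
  shows "kernel_dim (B * A) = kernel_dim A"
proof -
  from det_non_zero_imp_unit[OF B d, unfolded Units_def, of "()"]
  obtain C where C: "C \<in> carrier_mat n n" "C * B = 1\<^sub>m n" by (auto simp: ring_mat_def)
  show ?thesis
    unfolding kernel_dim_def using mat_kernel_mult_eq[OF A B C] A by simp
qed

lemma det_jordan_block_pow: 
  fixes a :: "'a::field"
  shows "Determinant.det (jordan_block n a ^\<^sub>m k) = (a ^ k) ^ n"
proof -
  have "Determinant.det (jordan_block n a ^\<^sub>m k) = prod_list (diag_mat (jordan_block n a ^\<^sub>m k))"
    by (rule det_upper_triangular[of _ n]) (auto simp: jordan_block_pow upper_triangular_def)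
  thus ?thesis by (simp add: diag_jordan_block_pow prod_list_replicate)
qed

lemma pow_mat_mult_commute:
  fixes X Y :: "'a::comm_ring_1 Matrix.mat"
  assumes X: "X \<in> carrier_mat n n" and Y: "Y \<in> carrier_mat n n" and XY: "X * Y = Y * X"
  shows "(X * Y) ^\<^sub>m k = X ^\<^sub>m k * Y ^\<^sub>m k"
proof -
  interpret R: semiring "ring_mat TYPE('a) n ()" by (rule semiring_mat)
  show ?thesis
    using R.pow_mult_distrib[of X Y k] assms
    by (simp add: pow_mat_ring_pow[where n = n and b = "()"] ring_mat_simps)
qed

text \<open>For \<open>J = J_n(e)\<close> factor \<open>J\<^sup>2 - ev\<^sup>2 = (J - ev)(J + ev)\<close> into the Jordan blocks with eigenvalues
  \<open>e - ev\<close> and \<open>e + ev\<close>. They commute, and as \<open>ev \<noteq> 0\<close> at most one of them is singular; a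
  nonsingular one can be cancelled without changing the kernel.\<close>

lemma kernel_dim_char_matrix_square_jordan_block:
  fixes e ev :: "'a::field_char_0"
  assumes ev: "ev \<noteq> 0"
  shows "kernel_dim (char_matrix (jordan_block n e * jordan_block n e) (ev * ev) ^\<^sub>m k)
       = (if e = ev then min k n else 0) + (if e = - ev then min k n else 0)"
proof -
  define P where "P = jordan_block n (e - ev)"
  define Q where "Q = jordan_block n (e + ev)"
  define J where "J = jordan_block n e"
  have c: "P \<in> carrier_mat n n" "Q \<in> carrier_mat n n" "J \<in> carrier_mat n n" 
    by (simp_all add: P_def Q_def J_def)
  have P: "P = J + (- ev) \<cdot>\<^sub>m 1\<^sub>m n" and Q: "Q = J + ev \<cdot>\<^sub>m 1\<^sub>m n"
    unfolding P_def Q_def J_def by (intro eq_matI; auto)+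
  have PQ: "P * Q = char_matrix (J * J) (ev * ev)" and QP: "Q * P = char_matrix (J * J) (ev * ev)"
    unfolding P Q char_matrix_def using c
    by (simp_all add: mult_add_distrib_mat[of _ n n _ n] add_mult_distrib_mat[of _ n n _ _ n]
       mult_smult_distrib[of _ n n _ n] mult_smult_assoc_mat[of _ n n _ n])
      (intro eq_matI; use c in \<open>auto simp: algebra_simps\<close>)+
  have comm: "P * Q = Q * P" using PQ QP by simp
  have pow: "char_matrix (J * J) (ev * ev) ^\<^sub>m k = P ^\<^sub>m k * Q ^\<^sub>m k"
    "char_matrix (J * J) (ev * ev) ^\<^sub>m k = Q ^\<^sub>m k * P ^\<^sub>m k"
    using pow_mat_mult_commute[OF c(1,2) comm, of k] pow_mat_mult_commute[OF c(2,1) comm[symmetric], of k] PQ QP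
    by simp_all
  have kd: "kernel_dim (jordan_block n a ^\<^sub>m k) = (if a = 0 then min k n else 0)" for a :: 'a
    unfolding kernel_dim_def jordan_block_pow_dim
    using dim_kernel_non_zero_jordan_block_pow[of a n k] dim_kernel_zero_jordan_block_pow[of n k, where 'a='a]
    by (cases "a = 0") simp_all
  show ?thesis
  proof (cases "e = ev")
    case True
    hence "Determinant.det (Q ^\<^sub>m k) \<noteq> 0" 
      unfolding Q_def det_jordan_block_pow using ev by simp
    hence "kernel_dim (Q ^\<^sub>m k * P ^\<^sub>m k) = kernel_dim (P ^\<^sub>m k)"
      using c by (intro kernel_dim_mult_left_nonsingular) auto
    thus ?thesis using True ev unfolding J_def[symmetric] pow(2) by (simp add: P_def kd)
  next
    case False
    hence "Determinant.det (P ^\<^sub>m k) \<noteq> 0" 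
      unfolding P_def det_jordan_block_pow by simp
    hence "kernel_dim (P ^\<^sub>m k * Q ^\<^sub>m k) = kernel_dim (Q ^\<^sub>m k)"
      using c by (intro kernel_dim_mult_left_nonsingular) auto
    thus ?thesis using False unfolding J_def[symmetric] pow(1) by (simp add: Q_def kd add_eq_0_iff2)
  qed
qed

text \<open>Both sides are additive over the diagonal blocks.\<close>

lemma dim_gen_eigenspace_square_jordan_matrix:
  fixes ev :: "'a::field_char_0"
  assumes ev: "ev \<noteq> 0"
  shows "dim_gen_eigenspace (jordan_matrix n_as * jordan_matrix n_as) (ev * ev) k
       = dim_gen_eigenspace (jordan_matrix n_as) ev k + dim_gen_eigenspace (jordan_matrix n_as) (- ev) k"
proof (induction n_as)
  case Nil
  have "dim_gen_eigenspace A e k = 0" if "A \<in> carrier_mat 0 0" for A :: "'a Matrix.mat" and e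
  proof -
    have "char_matrix A e ^\<^sub>m k = 1\<^sub>m 0" using that by (intro eq_matI) (auto simp: char_matrix_def)
    thus ?thesis using kernel_one_mat(1)[of 0, where 'a='a] by (simp add: dim_gen_eigenspace_def kernel_dim_def)
  qed
  moreover have "jordan_matrix [] \<in> carrier_mat 0 0"
    using jordan_matrix_carrier[of "[]"] by simp
  ultimately show ?case by (metis add_0 mult_carrier_mat)
next
  case (Cons ne n_as)
  obtain n e where ne: "ne = (n, e)" by force
  define m where "m = sum_list (map fst n_as)"
  define J where "J = jordan_matrix n_as"
  define D where "D = jordan_block n e"
  have c: "J \<in> carrier_mat m m" "D \<in> carrier_mat n n" by (auto simp: J_def m_def D_def)
  have sq: "jordan_matrix (ne # n_as) * jordan_matrix (ne # n_as)
      = four_block_mat (D * D) (0\<^sub>m n m) (0\<^sub>m m n) (J * J)"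
    unfolding ne jordan_matrix_Cons m_def[symmetric] J_def[symmetric] D_def[symmetric]
    by (subst mult_four_block_mat[where ?nr1.0 = n and ?n1.0 = n and ?n2.0 = m and ?nr2.0 = m and ?nc1.0 = n and ?nc2.0 = m])
       (use c in simp_all)
  have cm: "char_matrix (four_block_mat (D * D) (0\<^sub>m n m) (0\<^sub>m m n) (J * J)) (ev * ev)
     = four_block_mat (char_matrix (D * D) (ev * ev)) (0\<^sub>m n m) (0\<^sub>m m n) (char_matrix (J * J) (ev * ev))"
    unfolding char_matrix_def using c by (intro eq_matI) auto
  have DD: "char_matrix (D * D) (ev * ev) \<in> carrier_mat n n"
    and JJ: "char_matrix (J * J) (ev * ev) \<in> carrier_mat m m" using c by auto
  have "dim_gen_eigenspace (jordan_matrix (ne # n_as) * jordan_matrix (ne # n_as)) (ev * ev) k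
    = kernel.dim (n + m) (four_block_mat (char_matrix (D * D) (ev * ev) ^\<^sub>m k) (0\<^sub>m n m) (0\<^sub>m m n) (char_matrix (J * J) (ev * ev) ^\<^sub>m k))"
    unfolding dim_gen_eigenspace_def sq cm kernel_dim_def
    unfolding pow_four_block_mat[OF DD JJ]
    by (simp only: index_mat_four_block pow_mat_dim_square[OF DD] pow_mat_dim_square[OF JJ])
  also have "\<dots> = kernel_dim (char_matrix (D * D) (ev * ev) ^\<^sub>m k) + kernel_dim (char_matrix (J * J) (ev * ev) ^\<^sub>m k)"
    unfolding kernel_four_block_0_mat[OF refl pow_carrier_mat[OF DD] pow_carrier_mat[OF JJ]]
    by (simp only: kernel_dim_def pow_mat_dim_square[OF DD] pow_mat_dim_square[OF JJ])
  also have "\<dots> = dim_gen_eigenspace (jordan_matrix (ne # n_as)) ev k + dim_gen_eigenspace (jordan_matrix (ne # n_as)) (- ev) k"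
    using Cons.IH kernel_dim_char_matrix_square_jordan_block[OF ev, of n e k]
    unfolding J_def D_def by (simp add: dim_gen_eigenspace_jordan_matrix ne flip: dim_gen_eigenspace_def)
  finally show ?case .
qed

text \<open>The dimensions are invariant under similarity, so the Jordan form of \<open>A\<close> can replace \<open>A\<close>.\<close>

lemma dim_gen_eigenspace_square:
  fixes A :: "'a::field_char_0 Matrix.mat"
  assumes "jordan_nf A n_as" and ev: "ev \<noteq> 0"
  shows "dim_gen_eigenspace (A * A) (ev * ev) k = dim_gen_eigenspace A ev k + dim_gen_eigenspace A (- ev) k"
proof -
  let ?J = "jordan_matrix n_as"
  obtain P Q where wit: "similar_mat_wit A ?J P Q"
    using assms unfolding jordan_nf_def similar_mat_def by blast
  have pow2: "X ^\<^sub>m Suc (Suc 0) = X * X" if "X \<in> carrier_mat n n" for X :: "'a Matrix.mat" and n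
    using that by simp
  have "similar_mat (A * A) (?J * ?J)"
    using similar_mat_wit_pow[OF wit, of "Suc (Suc 0)"] similar_mat_witD(4,5)[OF refl wit]
    unfolding similar_mat_def by (metis pow2)
  moreover have "similar_mat A ?J" using wit unfolding similar_mat_def by blast
  ultimately show ?thesis
    using dim_gen_eigenspace_square_jordan_matrix[OF ev] by (simp add: dim_gen_eigenspace_similar)
qed

interpretation cnj_hom: comm_ring_hom cnj
  by unfold_locales auto

text \<open>Complex conjugation is a ring homomorphism, so it can be applied to the whole equation
  \<open>A = P J P\<^sup>-\<^sup>1\<close>.\<close>

lemma jordan_nf_cnj:
  assumes "jordan_nf A n_as"
  shows "jordan_nf (map_mat cnj A) (map (apsnd cnj) n_as)"
proof -
  let ?J = "jordan_matrix n_as" and ?n = "dim_row A"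
  obtain P Q where wit: "similar_mat_wit A ?J P Q"
    using assms unfolding jordan_nf_def similar_mat_def by blast
  note w = similar_mat_witD[OF refl wit]
  have "similar_mat_wit (map_mat cnj A) (map_mat cnj ?J) (map_mat cnj P) (map_mat cnj Q)"
  proof (rule similar_mat_witI)
    show "map_mat cnj P * map_mat cnj Q = 1\<^sub>m ?n" "map_mat cnj Q * map_mat cnj P = 1\<^sub>m ?n"
      using w(1,2) by (simp_all only: cnj_hom.mat_hom_mult[OF w(6,7), symmetric]
          cnj_hom.mat_hom_mult[OF w(7,6), symmetric] cnj_hom.mat_hom_one)
    show "map_mat cnj A = map_mat cnj P * map_mat cnj ?J * map_mat cnj Q"
      using arg_cong[OF w(3), of "map_mat cnj"]
      by (simp only: cnj_hom.mat_hom_mult[OF mult_carrier_mat[OF w(6,5)] w(7)] cnj_hom.mat_hom_mult[OF w(6,5)])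
  qed (simp_all only: map_carrier_mat w(4-7))
  moreover have "map_mat cnj ?J = jordan_matrix (map (apsnd cnj) n_as)"
  proof (induction n_as)
    case Nil
    show ?case by (intro eq_matI) auto
  next
    case (Cons ne n_as)
    obtain n e where ne: "ne = (n, e)" by force
    have f: "map fst (map (apsnd cnj) n_as) = map fst n_as" by simp
    have b: "map_mat cnj (jordan_block n e) = jordan_block n (cnj e)" by (intro eq_matI) auto
    show ?case
      unfolding ne list.map apsnd_conv jordan_matrix_Cons f Cons.IH[symmetric] b[symmetric]
      by (intro eq_matI) auto
  qed
  ultimately show ?thesis
    using assms unfolding jordan_nf_def similar_mat_def by (auto simp: image_comp)
qed

text \<open>A real matrix is its own conjugate, so conjugation permutes its Jordan blocks.\<close>

lemma dim_gen_eigenspace_cnj: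
  assumes jnf: "jordan_nf A n_as" and real: "map_mat cnj A = A"
  shows "dim_gen_eigenspace A (cnj ev) k = dim_gen_eigenspace A ev k"
proof -
  have "dim_gen_eigenspace A (cnj ev) k = (\<Sum>n\<leftarrow>map fst [(n, e)\<leftarrow>map (apsnd cnj) n_as. e = cnj ev]. min k n)"
    using dim_gen_eigenspace[OF jordan_nf_cnj[OF jnf]] real by simp
  also have "\<dots> = (\<Sum>n\<leftarrow>map fst [(n, e)\<leftarrow>n_as. e = ev]. min k n)"
    by (induction n_as) (auto simp: complex_cnj_cancel_iff)
  finally show ?thesis using dim_gen_eigenspace[OF jnf] by simp
qed

lemma complex_matrix_jordan_nf_exists:
  fixes A :: "complex Matrix.mat"
  assumes "A \<in> carrier_mat n n"
  shows "\<exists>n_as. jordan_nf A n_as"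
  using char_poly_factorized[OF assms] jordan_nf_exists[OF assms] by blast

text \<open>Let \<open>\<plusminus>\<i> r\<close> be the square roots of \<open>l < 0\<close>. The generalized eigenspaces of \<open>X\<close> for \<open>\<i> r\<close> and \<open>-\<i> r\<close> have equal
  dimensions because \<open>X\<close> is real, so each \<open>dim ker (X\<^sup>2 - l)\<^sup>k\<close> is twice one of them. The number
  of blocks of size \<open>m\<close> is \<open>2 d(m) - d(m - 1) - d(m + 1)\<close> in terms of these dimensions \<open>d(k)\<close>, hence
  even.\<close>

lemma even_jordan_blocks_square:
  fixes X :: "complex Matrix.mat"
  assumes X: "X \<in> carrier_mat n n" and real: "map_mat cnj X = X"
    and jnf: "jordan_nf (X * X) n_as" and l: "l < 0" and m: "m \<ge> 1"
  shows "even (count_list n_as (m, complex_of_real l))"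
proof -
  define ev where "ev = \<i> * complex_of_real (sqrt (- l))"
  have ev: "ev \<noteq> 0" "ev * ev = complex_of_real l" "cnj ev = - ev"
    using l by (auto simp: ev_def algebra_simps simp flip: of_real_mult)
  obtain m_bs where jX: "jordan_nf X m_bs" using complex_matrix_jordan_nf_exists[OF X] by blast
  have even_dim: "even (dim_gen_eigenspace (X * X) (complex_of_real l) k)" for k
    using dim_gen_eigenspace_square[OF jX ev(1), of k] dim_gen_eigenspace_cnj[OF jX real, of ev k] ev
    by simp
  have "count_list n_as (m, complex_of_real l) = length (filter ((=) (m, complex_of_real l)) n_as)"
    by (simp add: count_list_eq_length_filter)
  also have "\<dots> = compute_nr_of_jordan_blocks (X * X) (complex_of_real l) m"
    using m by (subst compute_nr_of_jordan_blocks[OF jnf]) auto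
  finally show ?thesis 
    unfolding compute_nr_of_jordan_blocks_def using even_dim by simp
qed

lemma complex_mat_carrier [simp]: "complex_mat (A :: real^'n^'n) \<in> carrier_mat CARD('n) CARD('n)"
  by (simp add: complex_mat_def)

lemma complex_mat_mult: "complex_mat (A ** B) = complex_mat A * complex_mat (B :: real^'n^'n)"
proof (rule eq_matI)
  fix i j assume "i < dim_row (complex_mat A * complex_mat B)" "j < dim_col (complex_mat A * complex_mat B)"
  hence ij: "i < CARD('n)" "j < CARD('n)" by (simp_all add: complex_mat_def)
  have bij: "bij_betw (from_nat_into (UNIV :: 'n set)) {0..<CARD('n)} UNIV"
    using bij_betw_from_nat_into_finite[of "UNIV :: 'n set"] by (simp add: atLeast0LessThan)
  show "complex_mat (A ** B) $$ (i, j) = (complex_mat A * complex_mat B) $$ (i, j)"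
    using ij sum.reindex_bij_betw[OF bij, of "\<lambda>k. complex_of_real (A $ from_nat_into UNIV i $ k) * complex_of_real (B $ k $ from_nat_into UNIV j)"]
    by (simp add: complex_mat_def matrix_matrix_mult_def scalar_prod_def)
qed (simp_all add: complex_mat_def)

lemma cnj_complex_mat: "map_mat cnj (complex_mat A) = complex_mat A"
  by (intro eq_matI) (auto simp: complex_mat_def)

lemma even_jordan_blocks_complex_mat_square:
  assumes "jordan_nf (complex_mat (C ** C)) n_as" "l < 0" "m \<ge> 1"
  shows "even (count_list n_as (m, complex_of_real l))"
  using even_jordan_blocks_square[OF complex_mat_carrier cnj_complex_mat _ assms(2,3)] assms(1)
  by (simp add: complex_mat_mult)

section \<open>Curves with affine averages\<close>

theorem theorem1:
  fixes c :: "real \<Rightarrow> real^'n" and \<epsilon> :: real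
    and A :: "real \<Rightarrow> real^'n^'n" and b :: "real \<Rightarrow> real^'n"
    and B :: "real^'n^'n" and d :: "real^'n" and t\<^sub>0 :: real
  assumes c_smooth: "smooth_on UNIV c"
    and eps: "\<epsilon> > 0"
    and A_smooth: "smooth_on {-\<epsilon><..<\<epsilon>} A"
    and A_GL: "\<forall>s\<in>{-\<epsilon><..<\<epsilon>}. invertible (A s)"
    and b_smooth: "smooth_on {-\<epsilon><..<\<epsilon>} b"
    and affine: "\<forall>s\<in>{-\<epsilon><..<\<epsilon>}. \<forall>t. curve_average c s t = A s *v c t + b s"
    and inj: "inj_on (\<lambda>k. nth_vderiv k c t\<^sub>0) {1..CARD('n)}"
    and indep: "independent ((\<lambda>k. nth_vderiv k c t\<^sub>0) ` {1..CARD('n)})"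
    and B: "B = 2 *\<^sub>R nth_vderiv 2 A 0"
    and d: "d = 2 *\<^sub>R nth_vderiv 2 b 0"
  shows
    "(solves_ivp B d (c 0) (nth_vderiv 1 c 0) c \<and>
      (\<forall>f. solves_ivp B d (c 0) (nth_vderiv 1 c 0) f \<longrightarrow> f = c))
   \<and> ((\<forall>s\<in>{-\<epsilon><..<\<epsilon>}.
         nth_vderiv 2 A s = (A s - (1/2) *\<^sub>R mat 1) ** B \<and>
         nth_vderiv 2 b s = (A s - (1/2) *\<^sub>R mat 1) *v d) \<and>
      A 0 = mat 1 \<and> b 0 = 0 \<and> nth_vderiv 1 A 0 = 0 \<and> nth_vderiv 1 b 0 = 0)
   \<and> (\<forall>s\<in>{-\<epsilon><..<\<epsilon>}.
         A s = (1/2) *\<^sub>R (mat 1 + co B s) \<and>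
         (\<exists>n_as. jordan_nf (complex_mat (A s)) n_as) \<and>
         (\<forall>n_as. jordan_nf (complex_mat (A s)) n_as \<longrightarrow>
            (\<forall>l::real. \<forall>m\<ge>1. l < 0 \<longrightarrow> even (count_list n_as (m, complex_of_real l)))))"
proof -
  define I where "I = {-\<epsilon><..<\<epsilon>}"
  have I: "0 \<in> I" "is_interval I" "open I" using eps by (auto simp: I_def is_interval_oo)
  define c1 c2 A1 A2 b1 b2 where defs:
    "c1 = nth_vderiv 1 c" "c2 = nth_vderiv 2 c" "A1 = nth_vderiv 1 A" "A2 = nth_vderiv 2 A"
    "b1 = nth_vderiv 1 b" "b2 = nth_vderiv 2 b"
  have derivs: "(f has_vector_derivative nth_vderiv 1 f t) (at t)"
    "(nth_vderiv 1 f has_vector_derivative nth_vderiv 2 f t) (at t)"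
    if "smooth_on S f" "t \<in> S" for f :: "real \<Rightarrow> 'b::real_normed_vector" and S t
    using smooth_on_has_vector_derivative[OF that, of 0] smooth_on_has_vector_derivative[OF that, of 1]
    by (simp_all add: numeral_2_eq_2)
  note dc = derivs(1)[OF c_smooth UNIV_I, folded defs] derivs(2)[OF c_smooth UNIV_I, folded defs]
  note dA = derivs[OF A_smooth[folded I_def], folded defs]
  note db = derivs[OF b_smooth[folded I_def], folded defs]
  note aff = affine[folded I_def, rule_format]
  note affine_eq = affine_maps_equal_on_curve[OF c_smooth inj indep]

  (* Differentiating the hypothesis twice in s, with t fixed. *)
  have dAb: "((\<lambda>s. A s *v x + b s) has_vector_derivative A1 s *v x + b1 s) (at s)"
    "((\<lambda>s. A1 s *v x + b1 s) has_vector_derivative A2 s *v x + b2 s) (at s)" if "s \<in> I" for s x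
    by (intro has_vector_derivative_add dA db that
        bounded_linear.has_vector_derivative[OF bounded_linear_matrix_vector_mult_left])+
  have param1: "(1/4) *\<^sub>R (c1 (t + s) - c1 (t - s)) = A1 s *v c t + b1 s" if s: "s \<in> I" for s t
    using vector_derivative_unique_at[OF has_vector_derivative_transform_within_open[OF
        curve_average_deriv_param[OF dc(1)] I(3) s aff] dAb(1)[OF s]] .
  have param2: "(1/4) *\<^sub>R (c2 (t + s) + c2 (t - s)) = A2 s *v c t + b2 s" if s: "s \<in> I" for s t
    using vector_derivative_unique_at[OF has_vector_derivative_transform_within_open[OF
        curve_average_deriv_param2[OF dc(2)] I(3) s param1] dAb(2)[OF s]] .

  have "A 0 = mat 1 \<and> b 0 = 0"
  proof (rule affine_eq)
    fix t
    have "curve_average c 0 t = c t" by (simp add: curve_average_def vec_eq_iff)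
    thus "A 0 *v c t + b 0 = mat 1 *v c t + 0" using aff[OF I(1), of t] by simp
  qed
  hence init: "A 0 = mat 1" "b 0 = 0" by simp_all
  have "A1 0 = 0 \<and> b1 0 = 0"
    by (rule affine_eq) (simp flip: param1[OF I(1)])
  hence init1: "A1 0 = 0" "b1 0 = 0" by simp_all
  have ode: "c2 t = B *v c t + d" for t
  proof -
    have "(1/2) *\<^sub>R c2 t = A2 0 *v c t + b2 0"
      using param2[OF I(1), of t] by (simp flip: scaleR_2)
    hence "2 *\<^sub>R ((1/2) *\<^sub>R c2 t) = 2 *\<^sub>R (A2 0 *v c t + b2 0)" by (rule arg_cong)
    thus ?thesis
      by (simp add: B d defs scaleR_right_distrib scaleR_matrix_vector_assoc)
  qed

  (* Differentiating the hypothesis twice in t, with s fixed. *)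
  have time2: "curve_average c2 s t = A s *v c2 t" if s: "s \<in> I" for s t
  proof -
    have dconst: "((\<lambda>t. A s *v f t + x) has_vector_derivative A s *v f' + 0) (at t)"
      if "(f has_vector_derivative f') (at t)" for f f' x t
      by (intro has_vector_derivative_add has_vector_derivative_const that
          bounded_linear.has_vector_derivative[OF matrix_vector_mul_bounded_linear])
    have time1: "curve_average c1 s t = A s *v c1 t + 0" for t
      using vector_derivative_unique_at[OF curve_average_deriv_time[OF dc(1)]
          dconst[OF dc(1), of "b s", folded aff[OF s]]] .
    show ?thesis
      using vector_derivative_unique_at[OF curve_average_deriv_time[OF dc(2)]
          dconst[OF dc(2), of 0, folded time1]] by simp
  qed
  have ode_Ab: "A2 s = (A s - (1/2) *\<^sub>R mat 1) ** B \<and> b2 s = (A s - (1/2) *\<^sub>R mat 1) *v d"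
    if s: "s \<in> I" for s
  proof (rule affine_eq)
    fix t
    (* c2(t + s) + c2(t - s) is the average without its middle term 2 c2(t) *)
    have "A2 s *v c t + b2 s = curve_average c2 s t - (1/2) *\<^sub>R c2 t"
      unfolding param2[OF s, symmetric] by (simp add: curve_average_def vec_eq_iff field_simps)
    also have "\<dots> = (A s - (1/2) *\<^sub>R mat 1) *v c2 t"
      unfolding time2[OF s]
      by (simp add: matrix_vector_mult_diff_rdistrib flip: scaleR_matrix_vector_assoc)
    also have "\<dots> = ((A s - (1/2) *\<^sub>R mat 1) ** B) *v c t + (A s - (1/2) *\<^sub>R mat 1) *v d"
      unfolding ode by (simp only: matrix_vector_right_distrib matrix_vector_mul_assoc)
    finally show "A2 s *v c t + b2 s = \<dots>" .
  qed

  have A_co: "A s = (1/2) *\<^sub>R (mat 1 + co B s)" if "s \<in> I" for s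
    by (rule matrix_ode_solution_co[OF I(2,1), of A A1])
       (use dA ode_Ab init init1 that in auto)
  have A_square: "A s = co B (s / 2) ** co B (s / 2)" if "s \<in> I" for s
    using A_co[OF that] co_double[of B "s / 2"] by simp

  have solves: "solves_ivp B d (c 0) (c1 0) c"
    unfolding solves_ivp_def using dc ode by (intro exI[of _ c1]) simp
  show ?thesis
    unfolding I_def[symmetric] defs[symmetric]
  proof (intro conjI ballI allI impI)
    show "f = c" if "solves_ivp B d (c 0) (c1 0) f" for f
      by (rule ivp_solution_unique[OF that solves])
    show "\<exists>n_as. jordan_nf (complex_mat (A s)) n_as" for s
      by (rule complex_matrix_jordan_nf_exists[OF complex_mat_carrier])
    show "even (count_list n_as (m, complex_of_real l))"
      if "s \<in> I" "jordan_nf (complex_mat (A s)) n_as" "1 \<le> m" "l < 0" for s n_as m l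
      using even_jordan_blocks_complex_mat_square that unfolding A_square[OF \<open>s \<in> I\<close>] by blast
  qed (use solves ode_Ab A_co init init1 in auto)
qed

end
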